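(* Let $X=(\coprod\sigma_i)/\!\sim$ be an ideal stacky fan, and suppose we have an admissible action of a group $G$ on $X$. Then we have a homeomorphism $$X/G\cong X/\!/G$$ between the global quotient (the set of $G$-orbits of $X$ with the quotient topology) and the stratified quotient.
   Context: A rational polyhedral cone in a finite-dimensional real vector space $V$ with a fixed lattice $N$ is a closed convex set $\bar\sigma=\{\sum_k\lambda_kx_k:\lambda_k\ge0\}$ for finitely many $x_k\in N$. An ideal cone $\sigma$ is a convex subset of $V$ obtained from such a $\bar\sigma$ by removing some (possibly none) of its faces; $\sigma^0$ is its relative interior; a face of $\sigma$ is the intersection of $\sigma$ with a face of $\bar\sigma$. For ideal cones $\sigma\subseteq V$, $\sigma'\subseteq V'$ (lattices $N,N'$), a linear map $L:V\to V'$ is a lattice-preserving inclusion if it induces an inclusion $\sigma\hookrightarrow\sigma'$ identifying $\sigma$ with a face of $\sigma'$ and $L(N\cap\operatorname{span}\sigma)=N'\cap L(\operatorname{span}\sigma)$. Given a (possibly infinite) collection of ideal cones $\{\sigma_i\subseteq V_i\}$ in finite-dimensional real vector spaces with lattices and a collection of lattice-preserving inclusions $L_\alpha:\sigma_i\hookrightarrow\sigma_j$ ($i=j$ allowed; called inclusions of faces), let $X=(\coprod\sigma_i)/\!\sim$ with the quotient topology, $\sim$ generated by $x\sim L_\alpha(x)$. If $X=\coprod(\sigma_i^0/\!\sim)$ as sets (every point is represented by a point of $\sigma_i^0$ for exactly one $i$), $X$ is an ideal stacky fan with cells $\{\sigma_i^0/\!\sim\}$. An action of $G$ on $X$ is admissible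 if for each $\gamma\in G$ and each $\sigma_i$ there are some (necessarily unique) $\sigma_j=:\sigma_i\cdot\gamma$ and a lattice-preserving isomorphism $L_{\gamma,i}:\sigma_i\to\sigma_j$ such that $\sigma_i\to X\xrightarrow{\gamma}X$ equals $\sigma_i\xrightarrow{L_{\gamma,i}}\sigma_j\to X$; then $\sigma_i,\sigma_j$ are said to be in the same $G$-orbit. Let $\{\sigma_j\}_{j\in\mathcal J}$ be a set of representatives of the $G$-orbits of cones. The stratified quotient is $X/\!/G=(\coprod_{j\in\mathcal J}\sigma_j)/\!\sim'$, where the quotient is over all identifications given by composite maps of the form $\sigma_i\xrightarrow{L_{\gamma,i}}\sigma_i\cdot\gamma\xrightarrow{L_\alpha}\sigma_j$ for all $\gamma\in G$ and all $i,j$ in $\mathcal J$.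
   Formalization: In X//G the maps L_α range over all lattice-preserving inclusions of faces compatible with the maps to X, not only the given collection; with the literal collection the claim fails (one cone ℝ, no inclusions, Z/2 acting by −1: X/G=[0,∞) but X//G=ℝ). *)

theory Defs
  imports "HOL-Analysis.Analysis" "HOL-Algebra.Group"
begin

section \<open>Quotient spaces\<close>

definition quotient_topology :: "'a topology \<Rightarrow> ('a \<times> 'a) set \<Rightarrow> 'a set topology" where
  "quotient_topology X R =
    topology (\<lambda>U. U \<subseteq> topspace X // R \<and> openin X {x \<in> topspace X. R `` {x} \<in> U})"

lemma openin_quotient_topology:
  "openin (quotient_topology X R) U \<longleftrightarrow>
    U \<subseteq> topspace X // R \<and> openin X {x \<in> topspace X. R `` {x} \<in> U}"
proof -
  have "istopology (\<lambda>U. U \<subseteq> topspace X // R \<and> openin X {x \<in> topspace X. R `` {x} \<in> U})"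
  proof -
    have 1: "{x \<in> topspace X. R `` {x} \<in> S \<inter> T} =
        {x \<in> topspace X. R `` {x} \<in> S} \<inter> {x \<in> topspace X. R `` {x} \<in> T}" for S T
      by auto
    have 2: "{x \<in> topspace X. R `` {x} \<in> \<Union>\<K>} = (\<Union>K\<in>\<K>. {x \<in> topspace X. R `` {x} \<in> K})" for \<K>
      by auto
    show ?thesis
      unfolding istopology_def 1 2 by blast
  qed
  then show ?thesis
    by (simp add: quotient_topology_def)
qed

lemma topspace_quotient_topology [simp]:
  "topspace (quotient_topology X R) = topspace X // R"
proof -
  have "{x \<in> topspace X. R `` {x} \<in> topspace X // R} = topspace X"
    by (auto intro: quotientI)
  then have "openin (quotient_topology X R) (topspace X // R)"
    by (simp add: openin_quotient_topology)
  then show ?thesis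
    by (meson openin_quotient_topology openin_subset openin_topspace subset_antisym)
qed

lemma quotient_map_quotient_topology:
  "quotient_map X (quotient_topology X R) (\<lambda>x. R `` {x})"
  by (auto simp: quotient_map_def openin_quotient_topology quotient_def)

definition equiv_generated :: "'a set \<Rightarrow> ('a \<Rightarrow> 'a \<Rightarrow> bool) \<Rightarrow> ('a \<times> 'a) set" where
  "equiv_generated A r = {(p, q). p \<in> A \<and> q \<in> A \<and> equivclp r p q}"

lemma equiv_equiv_generated: "equiv A (equiv_generated A r)"
  by (auto simp: equiv_def equiv_generated_def refl_on_def sym_def trans_def
      intro: equivclp_sym equivclp_trans)


section \<open>Ideal cones\<close>

text \<open>
  A finite-dimensional real vector space is rendered as a finite-dimensional subspace \<open>V\<close> of a
  real inner product space \<open>'v\<close> that need not be finite-dimensional, so that an infinite family of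
  spaces of unbounded dimension fits into one type. The subspace topology on \<open>V\<close> is
  the usual topology of a finite-dimensional space; the inner product plays no other role.
  A lattice in \<open>V\<close> is the integral span of a basis of \<open>V\<close>; its existence makes \<open>V\<close>
  finite-dimensional.
\<close>

definition lattice_in :: "'v::real_vector set \<Rightarrow> 'v set \<Rightarrow> bool" where
  "lattice_in V N \<longleftrightarrow>
    (\<exists>B. finite B \<and> independent B \<and> span B = V \<and>
         N = {\<Sum>b\<in>B. of_int (c b) *\<^sub>R b | c :: 'v \<Rightarrow> int. True})"

definition rational_polyhedral_cone :: "'v::real_vector set \<Rightarrow> 'v set \<Rightarrow> bool" where
  "rational_polyhedral_cone N C \<longleftrightarrow>
    (\<exists>X. finite X \<and> X \<subseteq> N \<and> C = {\<Sum>x\<in>X. l x *\<^sub>R x | l :: 'v \<Rightarrow> real. \<forall>x\<in>X. 0 \<le> l x})"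

text \<open>
  Since \<open>C face_of C\<close>, the condition \<open>S \<noteq> {}\<close> says that only proper faces are
  removed. The relative interior of \<open>C\<close> then lies in \<open>S\<close>, whence \<open>C = closure S\<close> and the relative
  interiors of \<open>S\<close> and \<open>C\<close> agree.
\<close>

definition ideal_cone :: "'v::real_inner set \<Rightarrow> 'v set \<Rightarrow> bool" where
  "ideal_cone N S \<longleftrightarrow>
    (\<exists>C \<F>. rational_polyhedral_cone N C \<and> (\<forall>T\<in>\<F>. T face_of C) \<and> S = C - \<Union>\<F>) \<and>
    convex S \<and> S \<noteq> {}"

definition ideal_face :: "'v::real_inner set \<Rightarrow> 'v set \<Rightarrow> bool" where
  "ideal_face F S \<longleftrightarrow> (\<exists>T. T face_of closure S \<and> F = S \<inter> T)"

text \<open>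
  A linear map \<open>V \<rightarrow> V'\<close> is given as the restriction of a linear map on the whole type; every
  linear map on a subspace extends in this way.
\<close>

definition lattice_preserving_inclusion ::
  "'v::real_inner set \<Rightarrow> 'v set \<Rightarrow> 'v set \<Rightarrow> 'v set \<Rightarrow> 'v set \<Rightarrow> 'v set \<Rightarrow> ('v \<Rightarrow> 'v) \<Rightarrow> bool" where
  "lattice_preserving_inclusion V N S V' N' S' L \<longleftrightarrow>
    linear L \<and> L ` V \<subseteq> V' \<and> inj_on L S \<and> ideal_face (L ` S) S' \<and>
    L ` (N \<inter> span S) = N' \<inter> L ` span S"

definition lattice_preserving_iso ::
  "'v::real_inner set \<Rightarrow> 'v set \<Rightarrow> 'v set \<Rightarrow> 'v set \<Rightarrow> 'v set \<Rightarrow> 'v set \<Rightarrow> ('v \<Rightarrow> 'v) \<Rightarrow> bool" where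
  "lattice_preserving_iso V N S V' N' S' L \<longleftrightarrow>
    lattice_preserving_inclusion V N S V' N' S' L \<and> L ` S = S'"


section \<open>Ideal stacky fans\<close>

text \<open>
  A triple \<open>(i, j, L) \<in> fincl F\<close> is an inclusion of faces \<open>L\<close> from the \<open>i\<close>-th cone to the \<open>j\<close>-th.
\<close>

record ('i, 'v) fan_data =
  findex :: "'i set"
  fspace :: "'i \<Rightarrow> 'v set"
  flattice :: "'i \<Rightarrow> 'v set"
  fcone :: "'i \<Rightarrow> 'v set"
  fincl :: "('i \<times> 'i \<times> ('v \<Rightarrow> 'v)) set"

abbreviation incl_between ::
  "('i, 'v::real_inner) fan_data \<Rightarrow> 'i \<Rightarrow> 'i \<Rightarrow> ('v \<Rightarrow> 'v) \<Rightarrow> bool" where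
  "incl_between F i j L \<equiv>
    lattice_preserving_inclusion (fspace F i) (flattice F i) (fcone F i)
      (fspace F j) (flattice F j) (fcone F j) L"

abbreviation iso_between ::
  "('i, 'v::real_inner) fan_data \<Rightarrow> 'i \<Rightarrow> 'i \<Rightarrow> ('v \<Rightarrow> 'v) \<Rightarrow> bool" where
  "iso_between F i j L \<equiv>
    lattice_preserving_iso (fspace F i) (flattice F i) (fcone F i)
      (fspace F j) (flattice F j) (fcone F j) L"

definition cone_coproduct ::
  "('i, 'v::real_inner) fan_data \<Rightarrow> 'i set \<Rightarrow> ('i \<times> 'v) topology" where
  "cone_coproduct F J = sum_topology (\<lambda>i. top_of_set (fcone F i)) J"

definition fan_equiv :: "('i, 'v::real_inner) fan_data \<Rightarrow> (('i \<times> 'v) \<times> ('i \<times> 'v)) set" where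
  "fan_equiv F =
    equiv_generated (SIGMA i:findex F. fcone F i)
      (\<lambda>p q. \<exists>i j L x. (i, j, L) \<in> fincl F \<and> x \<in> fcone F i \<and> p = (i, x) \<and> q = (j, L x))"

definition fan_space :: "('i, 'v::real_inner) fan_data \<Rightarrow> ('i \<times> 'v) set topology" where
  "fan_space F = quotient_topology (cone_coproduct F (findex F)) (fan_equiv F)"

definition fan_point :: "('i, 'v::real_inner) fan_data \<Rightarrow> 'i \<Rightarrow> 'v \<Rightarrow> ('i \<times> 'v) set" where
  "fan_point F i x = fan_equiv F `` {(i, x)}"

definition ideal_stacky_fan :: "('i, 'v::real_inner) fan_data \<Rightarrow> bool" where
  "ideal_stacky_fan F \<longleftrightarrow>
    (\<forall>i\<in>findex F. lattice_in (fspace F i) (flattice F i) \<and> ideal_cone (flattice F i) (fcone F i)) \<and>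
    (\<forall>(i, j, L)\<in>fincl F. i \<in> findex F \<and> j \<in> findex F \<and> incl_between F i j L) \<and>
    (\<forall>p\<in>topspace (fan_space F).
      \<exists>!i. i \<in> findex F \<and> (\<exists>x\<in>rel_interior (fcone F i). p = fan_point F i x))"

text \<open>
  All inclusions of faces of the fan: the lattice-preserving inclusions that commute with the maps
  to the quotient. Adjoining them to \<open>fincl F\<close> does not change \<open>fan_equiv F\<close>. The given collection
  itself need not contain identities, nor be closed under composition or under a group action.
\<close>

definition face_inclusions ::
  "('i, 'v::real_inner) fan_data \<Rightarrow> ('i \<times> 'i \<times> ('v \<Rightarrow> 'v)) set" where
  "face_inclusions F =
    {(i, j, L). i \<in> findex F \<and> j \<in> findex F \<and> incl_between F i j L \<and>
                (\<forall>x\<in>fcone F i. fan_point F i x = fan_point F j (L x))}"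

lemma equiv_fan_equiv: "equiv (SIGMA i:findex F. fcone F i) (fan_equiv F)"
  unfolding fan_equiv_def by (rule equiv_equiv_generated)

lemma fincl_subset_face_inclusions:
  assumes "ideal_stacky_fan F"
  shows "fincl F \<subseteq> face_inclusions F"
proof clarify
  fix i j L assume *: "(i, j, L) \<in> fincl F"
  then have ij: "i \<in> findex F" "j \<in> findex F" "incl_between F i j L"
    using assms by (auto simp: ideal_stacky_fan_def)
  have "fan_point F i x = fan_point F j (L x)" if x: "x \<in> fcone F i" for x
  proof -
    have "L x \<in> fcone F j"
      using ij(3) x by (auto simp: lattice_preserving_inclusion_def ideal_face_def)
    then have "((i, x), (j, L x)) \<in> fan_equiv F"
      unfolding fan_equiv_def equiv_generated_def using * ij(1,2) x
      by (simp, intro r_into_equivclp) blast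
    then show ?thesis
      unfolding fan_point_def
      by (rule equiv_class_eq[OF equiv_fan_equiv])
  qed
  then show "(i, j, L) \<in> face_inclusions F"
    using ij by (simp add: face_inclusions_def)
qed

lemma fan_equiv_face_inclusions:
  assumes "ideal_stacky_fan F"
  shows "fan_equiv (F\<lparr>fincl := face_inclusions F\<rparr>) = fan_equiv F"
proof -
  define r where "r \<L> p q \<longleftrightarrow>
    (\<exists>i j L x. (i, j, L) \<in> \<L> \<and> x \<in> fcone F i \<and> p = (i, x) \<and> q = (j, L x))"
    for \<L> :: "('a \<times> 'a \<times> ('b \<Rightarrow> 'b)) set" and p q
  have fan_equiv: "fan_equiv (F\<lparr>fincl := \<L>\<rparr>) =
      equiv_generated (SIGMA i:findex F. fcone F i) (r \<L>)" for \<L>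
    by (simp add: fan_equiv_def r_def[abs_def])
  have fan_equiv_F: "fan_equiv F = equiv_generated (SIGMA i:findex F. fcone F i) (r (fincl F))"
    using fan_equiv[of "fincl F"] by simp
  have 1: "equivclp (r (fincl F)) p q" if r: "r (face_inclusions F) p q" for p q
  proof -
    from r obtain i j L x where *: "(i, j, L) \<in> face_inclusions F" "x \<in> fcone F i"
      "p = (i, x)" "q = (j, L x)"
      unfolding r_def by blast
    have "incl_between F i j L" "i \<in> findex F" "j \<in> findex F"
      and pt: "fan_equiv F `` {p} = fan_equiv F `` {q}"
      using * by (simp_all add: face_inclusions_def fan_point_def)
    moreover from this have "L x \<in> fcone F j"
      using *(2) by (auto simp: lattice_preserving_inclusion_def ideal_face_def)
    ultimately have "(p, q) \<in> fan_equiv F"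
      using * by (intro eq_equiv_class[OF pt equiv_fan_equiv]) simp
    then show ?thesis
      by (simp add: fan_equiv_F equiv_generated_def)
  qed
  have 2: "r (fincl F) p q \<Longrightarrow> r (face_inclusions F) p q" for p q
    using fincl_subset_face_inclusions[OF assms] unfolding r_def by blast
  have "equivclp (r (face_inclusions F)) p q \<Longrightarrow> equivclp (r (fincl F)) p q" for p q
  proof (induction rule: equivclp_induct)
    case (step y z)
    from step.hyps(2) have "equivclp (r (fincl F)) y z"
      using 1 equivclp_sym by metis
    with step.IH show ?case
      by (rule equivclp_trans)
  qed simp
  moreover have "equivclp (r (fincl F)) p q \<Longrightarrow> equivclp (r (face_inclusions F)) p q" for p q
  proof (induction rule: equivclp_induct)
    case (step y z)
    from step.hyps(2) have "equivclp (r (face_inclusions F)) y z"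
      using 2 r_into_equivclp equivclp_sym by metis
    with step.IH show ?case
      by (rule equivclp_trans)
  qed simp
  ultimately have "equivclp (r (face_inclusions F)) = equivclp (r (fincl F))"
    by (intro ext iffI)
  then show ?thesis
    by (simp add: fan_equiv fan_equiv_F equiv_generated_def)
qed


section \<open>Admissible actions and the two quotients\<close>

definition right_action :: "('g, 'b) monoid_scheme \<Rightarrow> 'p set \<Rightarrow> ('p \<Rightarrow> 'g \<Rightarrow> 'p) \<Rightarrow> bool" where
  "right_action G P act \<longleftrightarrow>
    (\<forall>p\<in>P. \<forall>g\<in>carrier G. act p g \<in> P) \<and>
    (\<forall>p\<in>P. act p \<one>\<^bsub>G\<^esub> = p) \<and>
    (\<forall>p\<in>P. \<forall>g\<in>carrier G. \<forall>h\<in>carrier G. act p (g \<otimes>\<^bsub>G\<^esub> h) = act (act p g) h)"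

text \<open>
  The index \<open>mv i g\<close> and the map \<open>M g i\<close> are a choice of the translated cone and of the
  isomorphism onto it that admissibility provides. Admissibility forces each element of the group
  to act continuously, so continuity is not required separately.
\<close>

definition admissible_action ::
  "('i, 'v::real_inner) fan_data \<Rightarrow> ('g, 'b) monoid_scheme \<Rightarrow> (('i \<times> 'v) set \<Rightarrow> 'g \<Rightarrow> ('i \<times> 'v) set) \<Rightarrow>
    ('i \<Rightarrow> 'g \<Rightarrow> 'i) \<Rightarrow> ('g \<Rightarrow> 'i \<Rightarrow> 'v \<Rightarrow> 'v) \<Rightarrow> bool" where
  "admissible_action F G act mv M \<longleftrightarrow>
    right_action G (topspace (fan_space F)) act \<and>
    (\<forall>g\<in>carrier G. \<forall>i\<in>findex F.
      mv i g \<in> findex F \<and> iso_between F i (mv i g) (M g i) \<and>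
      (\<forall>x\<in>fcone F i. act (fan_point F i x) g = fan_point F (mv i g) (M g i x)))"

definition orbit_representatives ::
  "('i, 'v) fan_data \<Rightarrow> ('g, 'b) monoid_scheme \<Rightarrow> ('i \<Rightarrow> 'g \<Rightarrow> 'i) \<Rightarrow> 'i set \<Rightarrow> bool" where
  "orbit_representatives F G mv J \<longleftrightarrow>
    J \<subseteq> findex F \<and> (\<forall>i\<in>findex F. \<exists>!j. j \<in> J \<and> (\<exists>g\<in>carrier G. mv i g = j))"

definition global_quotient ::
  "('i, 'v::real_inner) fan_data \<Rightarrow> ('g, 'b) monoid_scheme \<Rightarrow> (('i \<times> 'v) set \<Rightarrow> 'g \<Rightarrow> ('i \<times> 'v) set) \<Rightarrow>
    ('i \<times> 'v) set set topology" where
  "global_quotient F G act =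
    quotient_topology (fan_space F)
      {(p, q). p \<in> topspace (fan_space F) \<and> (\<exists>g\<in>carrier G. q = act p g)}"

text \<open>
  The second factor of a composite ranges over all inclusions of faces of the fan, not only over
  the generating collection \<open>fincl F\<close>. For instance, let the group of order two act by negation on
  the fan with the single cone \<open>\<real>\<close> and \<open>fincl F = {}\<close>: no composite ends in \<open>fincl F\<close>, and
  nothing would be identified.
\<close>

definition stratified_quotient ::
  "('i, 'v::real_inner) fan_data \<Rightarrow> ('g, 'b) monoid_scheme \<Rightarrow>
    ('i \<Rightarrow> 'g \<Rightarrow> 'i) \<Rightarrow> ('g \<Rightarrow> 'i \<Rightarrow> 'v \<Rightarrow> 'v) \<Rightarrow> 'i set \<Rightarrow> ('i \<times> 'v) set topology" where
  "stratified_quotient F G mv M J =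
    quotient_topology (cone_coproduct F J)
      (equiv_generated (SIGMA j:J. fcone F j)
        (\<lambda>p q. \<exists>i\<in>J. \<exists>j\<in>J. \<exists>g\<in>carrier G. \<exists>L. \<exists>x\<in>fcone F i.
            (mv i g, j, L) \<in> face_inclusions F \<and> p = (i, x) \<and> q = (j, L (M g i x))))"

end

theory Submission
  imports Defs
begin

text \<open>
  Both spaces are quotients of the coproduct of all cones. One composes the projection to the fan
  with the orbit map; the other moves each cone onto the representative of its orbit and then
  projects. The two quotient maps have the same fibres: if \<open>L\<close> is an inclusion of faces covering
  the action of \<open>g\<close>, then conjugating \<open>L\<close> by the maps onto representatives gives a composite of
  the form used for the stratified quotient.
\<close>

section \<open>Finite-dimensional subspaces of inner product spaces\<close>

text \<open>The obstacle is that the isomorphisms \<open>M g i\<close> are chosen, not canonical. A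
  cone may map to the fan non-injectively, so \<open>M (g \<otimes> h) i\<close> and
  \<open>M h (mv i g) \<circ> M g i\<close> need only agree after projection to the fan, and
  inverses do not cancel on the nose. What behaves strictly is the target index: since cells are
  disjoint, \<open>mv\<close> is an action on indices. The discrepancy between two choices of maps
  is then a self-map of a cone covering the unit of the group, and such self-maps only identify
  points that the stratified quotient identifies anyway. A second obstacle is that the ambient space
  may be infinite-dimensional while faces are taken from closures, so closures and continuity of
  linear maps have to be controlled on finite-dimensional spans.\<close>

lemma orthogonal_expansion:
  fixes C :: "'a::real_inner set"
  assumes "finite C" "pairwise orthogonal C" "x \<in> span C"
  shows "(\<Sum>c\<in>C. ((x \<bullet> c) / (c \<bullet> c)) *\<^sub>R c) = x"
  using assms(3)
proof (induction rule: span_induct_alt)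
  case base
  show ?case by simp
next
  case (step a b y)
  \<comment> \<open>A zero vector in \<open>C\<close> is harmless: whatever its coefficient, its
    term is 0.\<close>
  have "(\<Sum>c\<in>C. ((b \<bullet> c) / (c \<bullet> c)) *\<^sub>R c) = (\<Sum>c\<in>C. if c = b then b else 0)"
  proof (rule sum.cong)
    show "((b \<bullet> c) / (c \<bullet> c)) *\<^sub>R c = (if c = b then b else 0)" if "c \<in> C" for c
      using assms(2) step(1) that by (auto simp: pairwise_def orthogonal_def)
  qed simp
  also have "\<dots> = b"
    using assms(1) step(1) by simp
  finally have b: "(\<Sum>c\<in>C. ((b \<bullet> c) / (c \<bullet> c)) *\<^sub>R c) = b" .
  have "(\<Sum>c\<in>C. (((a *\<^sub>R b + y) \<bullet> c) / (c \<bullet> c)) *\<^sub>R c) =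
      a *\<^sub>R (\<Sum>c\<in>C. ((b \<bullet> c) / (c \<bullet> c)) *\<^sub>R c) + (\<Sum>c\<in>C. ((y \<bullet> c) / (c \<bullet> c)) *\<^sub>R c)"
    by (simp add: inner_add_left add_divide_distrib scaleR_add_left sum.distrib scaleR_sum_right)
  then show ?case
    using b step by simp
qed

text \<open>By orthogonal expansion the span is the fixed set of a continuous map, the projection
  onto it.\<close>

lemma closed_span_finite:
  fixes B :: "'a::real_inner set"
  assumes "finite B"
  shows "closed (span B)"
proof -
  obtain C where C: "finite C" "span C = span B" "pairwise orthogonal C"
    using basis_orthogonal[OF assms] by blast
  have span_eq: "span C = {x. (\<Sum>c\<in>C. ((x \<bullet> c) / (c \<bullet> c)) *\<^sub>R c) = x}"
  proof (intro equalityI subsetI CollectI)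
    show "x \<in> span C" if "x \<in> {x. (\<Sum>c\<in>C. ((x \<bullet> c) / (c \<bullet> c)) *\<^sub>R c) = x}" for x
    proof -
      have "(\<Sum>c\<in>C. ((x \<bullet> c) / (c \<bullet> c)) *\<^sub>R c) \<in> span C"
        by (intro span_sum span_scale span_base)
      with that show ?thesis by simp
    qed
  qed (rule orthogonal_expansion[OF C(1,3)])
  have "closed (span C)"
    unfolding span_eq divide_inverse by (intro closed_Collect_eq continuous_intros)
  then show ?thesis
    using C(2) by simp
qed

text \<open>On the span, \<open>f x\<close> is a finite sum of the fixed vectors \<open>f c\<close>
  with coefficients continuous in \<open>x\<close>. On the whole type \<open>f\<close> may be
  discontinuous.\<close>

lemma linear_continuous_on_span_finite:
  fixes f :: "'a::real_inner \<Rightarrow> 'b::real_normed_vector"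
  assumes "finite B" "linear f"
  shows "continuous_on (span B) f"
proof -
  obtain C where C: "finite C" "span C = span B" "pairwise orthogonal C"
    using basis_orthogonal[OF assms(1)] by blast
  have "f x = (\<Sum>c\<in>C. ((x \<bullet> c) * inverse (c \<bullet> c)) *\<^sub>R f c)" if "x \<in> span B" for x
  proof -
    have "f x = f (\<Sum>c\<in>C. ((x \<bullet> c) / (c \<bullet> c)) *\<^sub>R c)"
      using that C by (simp add: orthogonal_expansion)
    then show ?thesis
      using assms(2) by (simp add: linear_sum linear_scale divide_inverse)
  qed
  moreover have "continuous_on (span B) (\<lambda>x. \<Sum>c\<in>C. ((x \<bullet> c) * inverse (c \<bullet> c)) *\<^sub>R f c)"
    by (intro continuous_intros)
  ultimately show ?thesis
    by (simp cong: continuous_on_cong)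
qed

lemma closure_subset_span_finite:
  fixes S :: "'a::real_inner set"
  assumes "finite D" "S \<subseteq> span D"
  shows "closure S \<subseteq> span D"
  using assms closed_span_finite closure_minimal by blast

text \<open>Since faces of an ideal cone come from its closure, an isomorphism can transport faces
  only if it transports closures. Continuity of \<open>f\<close> gives one inclusion; the other
  comes from a linear left inverse, continuous on the finite-dimensional image.\<close>

lemma closure_linear_image_span_finite:
  fixes f :: "'a::real_inner \<Rightarrow> 'b::real_inner"
  assumes D: "finite D" "S \<subseteq> span D" and f: "linear f" "inj_on f (span D)"
  shows "closure (f ` S) = f ` closure S"
proof
  have cl: "closure S \<subseteq> span D"
    using D by (rule closure_subset_span_finite)
  show "f ` closure S \<subseteq> closure (f ` S)"
    using continuous_on_subset[OF linear_continuous_on_span_finite[OF D(1) f(1)] cl]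
    by (rule image_closure_subset) (auto intro: closure_subset[THEN subsetD])
  obtain g where g: "linear g" "\<forall>x\<in>span D. g (f x) = x"
    using linear_inj_on_left_inverse[OF f] by blast
  have img: "f ` span D = span (f ` D)"
    using f(1) by (simp add: linear_span_image)
  then have cl': "closure (f ` S) \<subseteq> span (f ` D)"
    using D by (intro closure_subset_span_finite) auto
  have "g ` closure (f ` S) \<subseteq> closure S"
  proof (rule image_closure_subset)
    show "continuous_on (closure (f ` S)) g"
      using continuous_on_subset[OF linear_continuous_on_span_finite[OF _ g(1)] cl'] D(1) by blast
    show "g ` f ` S \<subseteq> closure S"
      using g(2) D(2) closure_subset[of S] by (force simp: image_iff subset_iff)
  qed simp
  show "closure (f ` S) \<subseteq> f ` closure S"
  proof
    fix y assume y: "y \<in> closure (f ` S)"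
    then obtain x where x: "x \<in> span D" "y = f x"
      using cl' img by blast
    then have "x \<in> closure S"
      using \<open>g ` closure (f ` S) \<subseteq> closure S\<close> g(2) y by force
    then show "y \<in> f ` closure S"
      using x by blast
  qed
qed

text \<open>A segment between image points is the image of the segment between preimages;
  injectivity on the span recognizes the preimage of \<open>x\<close> as a point of that
  segment.\<close>

lemma face_of_linear_image_inj_on:
  assumes T: "T face_of C" and f: "linear f" and inj: "inj_on f (span C)"
  shows "f ` T face_of f ` C"
  unfolding face_of_def
proof (intro conjI ballI impI)
  show "f ` T \<subseteq> f ` C" "convex (f ` T)"
    using T f by (auto simp: face_of_def convex_linear_image)
next
  fix a b x
  assume "a \<in> f ` C" "b \<in> f ` C" "x \<in> f ` T" and x: "x \<in> open_segment a b"
  then obtain u v t where uvt: "u \<in> C" "a = f u" "v \<in> C" "b = f v" "t \<in> T" "x = f t"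
    by blast
  from x obtain s where s: "a \<noteq> b" "0 < s" "s < 1" "x = (1 - s) *\<^sub>R a + s *\<^sub>R b"
    by (auto simp: in_segment)
  have "t \<in> C"
    using T uvt(5) by (auto simp: face_of_def)
  moreover have "f t = f ((1 - s) *\<^sub>R u + s *\<^sub>R v)"
    using s(4) uvt f by (simp add: linear_add linear_scale)
  ultimately have "t = (1 - s) *\<^sub>R u + s *\<^sub>R v"
    using uvt by (intro inj_onD[OF inj]) (auto intro: span_base span_add span_scale)
  then have "t \<in> open_segment u v"
    using s uvt by (auto simp: in_segment)
  then have "u \<in> T" "v \<in> T"
    using T uvt by (auto simp: face_of_def)
  then show "a \<in> f ` T" "b \<in> f ` T"
    using uvt by auto
qed

section \<open>Ideal cones and their spans\<close>

lemma finite_basis_subset_lattice_in: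
  assumes "lattice_in V N" "S \<subseteq> V"
  obtains D where "finite D" "D \<subseteq> S" "independent D" "span D = span S"
proof -
  obtain B where B: "finite B" "span B = V"
    using assms(1) by (auto simp: lattice_in_def)
  obtain D where D: "D \<subseteq> S" "independent D" "S \<subseteq> span D"
    by (rule maximal_independent_subset)
  moreover have "span D = span S"
    using D by (metis span_eq span_superset subset_trans)
  moreover have "finite D"
    using independent_span_bound[OF B(1) D(2)] D(1) assms(2) B(2) by auto
  ultimately show ?thesis
    using that by blast
qed

lemma lattice_in_subset: "lattice_in V N \<Longrightarrow> N \<subseteq> V"
  by (auto simp: lattice_in_def intro!: span_sum intro: span_scale span_base)

lemma subspace_lattice_in: "lattice_in V N \<Longrightarrow> subspace V"
  by (auto simp: lattice_in_def)

lemma rational_polyhedral_cone_subset_span: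
  assumes "rational_polyhedral_cone N C"
  shows "C \<subseteq> span N"
  using assms by (auto simp: rational_polyhedral_cone_def intro!: span_sum intro: span_scale span_base)

lemma ideal_cone_subset:
  assumes "lattice_in V N" "ideal_cone N S"
  shows "S \<subseteq> V"
proof -
  have "S \<subseteq> span N"
    using assms(2) rational_polyhedral_cone_subset_span unfolding ideal_cone_def by blast
  also have "\<dots> \<subseteq> V"
    using assms(1) by (intro span_minimal lattice_in_subset subspace_lattice_in)
  finally show ?thesis .
qed

text \<open>Positive scaling survives the removal of faces because a face that meets the open ray
  through \<open>x\<close> contains \<open>x\<close>. The factor 0 is excluded: the apex may have
  been removed.\<close>

lemma ideal_cone_scaleR:
  fixes S :: "'a::real_inner set"
  assumes S: "ideal_cone N S" and x: "x \<in> S" and c: "0 < c"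
  shows "c *\<^sub>R x \<in> S"
proof (cases "x = 0")
  case False
  obtain C \<F> where C: "rational_polyhedral_cone N C" "\<forall>T\<in>\<F>. T face_of C" "S = C - \<Union>\<F>"
    using S by (auto simp: ideal_cone_def)
  have scale: "a *\<^sub>R y \<in> C" if y: "y \<in> C" and a: "0 \<le> a" for a y
  proof -
    obtain X where X: "C = {\<Sum>x\<in>X. l x *\<^sub>R x | l :: 'a \<Rightarrow> real. \<forall>x\<in>X. 0 \<le> l x}"
      using C(1) unfolding rational_polyhedral_cone_def by blast
    then obtain l where l: "y = (\<Sum>x\<in>X. l x *\<^sub>R x)" "\<forall>x\<in>X. 0 \<le> l x"
      using y by blast
    have "a *\<^sub>R y = (\<Sum>x\<in>X. (a * l x) *\<^sub>R x)"
      by (simp add: l(1) scaleR_sum_right)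
    moreover have "\<forall>x\<in>X. 0 \<le> a * l x"
      using l(2) a by simp
    ultimately show ?thesis
      unfolding X by (auto intro!: exI[of _ "\<lambda>x. a * l x"])
  qed
  have xC: "x \<in> C"
    using x C(3) by blast
  have "c *\<^sub>R x \<notin> T" if T: "T \<in> \<F>" for T
  proof
    assume cT: "c *\<^sub>R x \<in> T"
    \<comment> \<open>With \<open>m\<close> above \<open>c\<close>, the point
      \<open>c *\<^sub>R x\<close> is interior to the segment from 0 to
      \<open>m *\<^sub>R x\<close>, so a face through it contains both ends; with \<open>m\<close>
      at least 1, \<open>x\<close> lies between these ends.\<close>
    define m where "m = c + 1"
    have m: "0 < m" "c < m" "1 \<le> m"
      using c by (auto simp: m_def)
    have face: "T face_of C"
      using C(2) T by blast
    have "c *\<^sub>R x \<in> open_segment 0 (m *\<^sub>R x)"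
      using False m c by (auto simp: in_segment intro!: exI[of _ "c / m"])
    then have "0 \<in> T" "m *\<^sub>R x \<in> T"
      using face_ofD[OF face] scale[OF xC, of 0] scale[OF xC, of m] cT m by auto
    then have "(1 - 1 / m) *\<^sub>R 0 + (1 / m) *\<^sub>R (m *\<^sub>R x) \<in> T"
      using face_of_imp_convex[OF face] m by (intro convexD) auto
    then have "x \<in> T"
      using m by simp
    then show False
      using x C(3) T by blast
  qed
  then show ?thesis
    using scale[OF xC, of c] c C(3) by auto
qed (use x in simp)

lemma ideal_cone_add:
  assumes S: "ideal_cone N S" and "x \<in> S" "y \<in> S"
  shows "x + y \<in> S"
proof -
  have "(1/2) *\<^sub>R x + (1/2) *\<^sub>R y \<in> S"
    using assms by (intro convexD) (auto simp: ideal_cone_def)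
  from ideal_cone_scaleR[OF S this, of 2] show ?thesis
    by (simp add: scaleR_add_right)
qed

lemma ideal_cone_pos_combination:
  assumes S: "ideal_cone N S" and "finite D" "D \<noteq> {}" "D \<subseteq> S" "\<And>d. d \<in> D \<Longrightarrow> 0 < l d"
  shows "(\<Sum>d\<in>D. l d *\<^sub>R d) \<in> S"
  using assms(2-)
proof (induction rule: finite_ne_induct)
  case (singleton x)
  then show ?case
    using ideal_cone_scaleR[OF S] by simp
next
  case (insert x D)
  then show ?case
    using ideal_cone_scaleR[OF S] ideal_cone_add[OF S] by simp
qed

text \<open>Every vector of the span is a difference of two points of the cone, so a kernel vector
  yields two points of the cone with equal images.\<close>

lemma inj_on_span_ideal_cone:
  assumes S: "ideal_cone N S" and f: "linear f" "inj_on f S"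
  shows "inj_on f (span S)"
proof -
  have "\<exists>a b. x = a - b \<and> a \<in> S \<and> b \<in> S" if "x \<in> span S" for x
    using that
  proof (induction rule: span_induct_alt)
    case base
    obtain s where "s \<in> S"
      using S by (auto simp: ideal_cone_def)
    then show ?case
      by (intro exI[of _ s]) simp
  next
    case (step c s y)
    obtain a b where ab: "y = a - b" "a \<in> S" "b \<in> S"
      using step by blast
    consider "c = 0" | "0 < c" | "c < 0" by linarith
    then show ?case
    proof cases
      case 1
      then show ?thesis using ab by auto
    next
      case 2
      then show ?thesis
        using ab ideal_cone_add[OF S ideal_cone_scaleR[OF S step(1) 2] ab(2)]
        by (intro exI[of _ "c *\<^sub>R s + a"] exI[of _ b]) simp
    next
      case 3
      then show ?thesis
        using ab ideal_cone_add[OF S ideal_cone_scaleR[OF S step(1), of "- c"] ab(3)]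
        by (intro exI[of _ a] exI[of _ "- c *\<^sub>R s + b"]) simp
    qed
  qed
  then have "f x = 0 \<Longrightarrow> x = 0" if "x \<in> span S" for x
    using that f by (force simp: linear_diff dest: inj_onD)
  then show ?thesis
    using f(1) by (simp add: linear_inj_on_iff_eq_0)
qed

text \<open>Having only positive coordinates with respect to \<open>D\<close> is an open condition
  on the span and forces membership in \<open>S\<close>; all coordinates of \<open>\<Sum>D\<close>
  are 1. This particular interior point is useful because an injective linear map sends it to the
  sum of the image basis, so it can be followed through isomorphisms.\<close>

lemma sum_basis_in_rel_interior:
  fixes S :: "'a::real_inner set"
  assumes S: "ideal_cone N S"
    and D: "finite D" "D \<subseteq> S" "independent D" "span D = span S"
  shows "\<Sum>D \<in> rel_interior S"
proof -
  have "\<exists>g::'a \<Rightarrow> real. linear g \<and> (\<forall>b\<in>D. g b = (if b = d then 1 else 0))" for d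
    by (rule linear_independent_extend[OF D(3)])
  then obtain g :: "'a \<Rightarrow> 'a \<Rightarrow> real"
    where g: "\<And>d. linear (g d)" "\<And>b d. b \<in> D \<Longrightarrow> g d b = (if b = d then 1 else 0)"
    by metis
  have expand: "(\<Sum>d\<in>D. g d x *\<^sub>R d) = x" if "x \<in> span D" for x
  proof (rule linear_eq_on[OF _ linear_ident that])
    show "linear (\<lambda>x. \<Sum>d\<in>D. g d x *\<^sub>R d)"
      using g(1) by (intro linear_compose_sum ballI linear_compose[OF _ linear_scaleR_left, unfolded o_def])
    show "(\<Sum>d\<in>D. g d b *\<^sub>R d) = b" if "b \<in> D" for b
    proof -
      have "(\<Sum>d\<in>D. g d b *\<^sub>R d) = (\<Sum>d\<in>D. if d = b then b else 0)"
        using that by (intro sum.cong) (auto simp: g(2))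
      then show ?thesis
        using D(1) that by simp
    qed
  qed
  have pos: "x \<in> S" if "x \<in> span S" "\<And>d. d \<in> D \<Longrightarrow> 0 < g d x" for x
  proof (cases "D = {}")
    \<comment> \<open>An empty combination is 0, which an ideal cone need not contain; here
      \<open>S\<close> is nonempty inside {0}.\<close>
    case True
    then have "S \<subseteq> {0}" "x = 0"
      using D(4) that(1) span_superset[of S] by auto
    then show ?thesis
      using S by (auto simp: ideal_cone_def)
  next
    case False
    then show ?thesis
      using ideal_cone_pos_combination[OF S D(1) False D(2), of "\<lambda>d. g d x"] expand[of x] that D(4)
      by simp
  qed
  have sum: "g d (\<Sum>D) = 1" if "d \<in> D" for d
  proof -
    have "g d (\<Sum>D) = (\<Sum>b\<in>D. if b = d then 1 else 0)"
      using g by (simp add: linear_sum)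
    then show ?thesis
      using D(1) that by simp
  qed
  have sum_span: "\<Sum>D \<in> span D"
    by (intro span_sum span_base)
  have "openin (top_of_set (span D))
      ((\<Inter>d\<in>D. {x \<in> topspace (top_of_set (span D)). g d x \<in> {0<..}}) \<inter>
        topspace (top_of_set (span D)))"
    using D(1) linear_continuous_on_span_finite[OF D(1) g(1)]
    by (intro openin_INT openin_continuous_map_preimage[where Y = euclidean]) auto
  then obtain W where W: "open W"
    "(\<Inter>d\<in>D. {x \<in> span D. g d x \<in> {0<..}}) \<inter> span D = span D \<inter> W"
    by (auto simp: openin_open)
  have hull: "affine hull S \<subseteq> span S"
    by (rule affine_hull_subset_span)
  show ?thesis
    unfolding mem_rel_interior
  proof (intro exI[of _ W] conjI)
    show "\<Sum>D \<in> W \<inter> S"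
      using W(2) sum sum_span pos[of "\<Sum>D"] D(4) by auto
    show "W \<inter> affine hull S \<subseteq> S"
      using W(2) hull D(4) pos by blast
  qed (rule W(1))
qed

lemma linear_continuous_on_ideal_cone:
  fixes f :: "'a::real_inner \<Rightarrow> 'b::real_normed_vector"
  assumes "lattice_in V N" "ideal_cone N S" "linear f"
  shows "continuous_on S f"
proof -
  obtain B where "finite B" "span B = V"
    using assms(1) by (auto simp: lattice_in_def)
  then show ?thesis
    using linear_continuous_on_span_finite[OF _ assms(3)] ideal_cone_subset[OF assms(1,2)]
    by (blast intro: continuous_on_subset)
qed

section \<open>Composing lattice-preserving inclusions\<close>

text \<open>Precomposing with an isomorphism changes neither the image face nor its span.\<close>

lemma lattice_preserving_inclusion_iso_comp:
  assumes M: "lattice_preserving_iso V N S V' N' S' M"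
    and L: "lattice_preserving_inclusion V' N' S' V'' N'' S'' L"
  shows "lattice_preserving_inclusion V N S V'' N'' S'' (L \<circ> M)"
proof -
  have M': "linear M" "M ` V \<subseteq> V'" "inj_on M S" "M ` S = S'" "M ` (N \<inter> span S) = N' \<inter> M ` span S"
    using M by (simp_all add: lattice_preserving_iso_def lattice_preserving_inclusion_def)
  have L': "linear L" "L ` V' \<subseteq> V''" "inj_on L S'" "ideal_face (L ` S') S''"
    "L ` (N' \<inter> span S') = N'' \<inter> L ` span S'"
    using L by (simp_all add: lattice_preserving_inclusion_def)
  have span: "M ` span S = span S'"
    using M'(4) linear_span_image[OF M'(1), of S] by simp
  have "linear (L \<circ> M)" "inj_on (L \<circ> M) S"
    using M' L' by (simp_all add: linear_compose comp_inj_on)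
  then show ?thesis
    using M' L' span image_mono[OF M'(2), of L]
    unfolding lattice_preserving_inclusion_def image_comp[symmetric] by simp
qed

text \<open>In this order the face itself has to be moved. Injectivity of \<open>M\<close> on the
  whole span of \<open>S'\<close> lets it carry along the closure, its faces and the intersections
  with the lattice.\<close>

lemma lattice_preserving_iso_inclusion_comp:
  assumes V': "lattice_in V' N'" "ideal_cone N' S'"
    and L: "lattice_preserving_inclusion V N S V' N' S' L"
    and M: "lattice_preserving_iso V' N' S' V'' N'' S'' M"
  shows "lattice_preserving_inclusion V N S V'' N'' S'' (M \<circ> L)"
proof -
  have img: "M ` S' = S''" and lin: "linear M" and inj: "inj_on M S'"
    and latM: "M ` (N' \<inter> span S') = N'' \<inter> M ` span S'"
    using M by (auto simp: lattice_preserving_iso_def lattice_preserving_inclusion_def)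
  have linL: "linear L" and injL: "inj_on L S"
    and latL: "L ` (N \<inter> span S) = N' \<inter> L ` span S"
    using L by (auto simp: lattice_preserving_inclusion_def)
  obtain D where D: "finite D" "D \<subseteq> S'" "span D = span S'"
    using finite_basis_subset_lattice_in[OF V'(1) ideal_cone_subset[OF V']] by metis
  have inj_span: "inj_on M (span S')"
    using V'(2) lin inj by (rule inj_on_span_ideal_cone)
  have cl_sub: "closure S' \<subseteq> span S'"
    using closure_subset_span_finite[OF D(1), of S'] D(3) span_superset by metis
  have cl: "closure S'' = M ` closure S'"
    using closure_linear_image_span_finite[OF D(1) _ lin, of S'] D(3) inj_span img span_superset
    by metis
  obtain T where T: "T face_of closure S'" "L ` S = S' \<inter> T"
    using L by (auto simp: lattice_preserving_inclusion_def ideal_face_def)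
  have T_sub: "T \<subseteq> span S'"
    using T(1) cl_sub by (auto simp: face_of_def)
  have "M ` T face_of closure S''"
    unfolding cl
  proof (rule face_of_linear_image_inj_on[OF T(1) lin])
    show "inj_on M (span (closure S'))"
      using inj_span by (rule inj_on_subset) (simp add: span_minimal cl_sub)
  qed
  moreover have "(M \<circ> L) ` S = S'' \<inter> M ` T"
    using inj_on_image_Int[OF inj_span span_superset T_sub] T(2) img unfolding image_comp[symmetric] by simp
  ultimately have face: "ideal_face ((M \<circ> L) ` S) S''"
    unfolding ideal_face_def by blast
  have LS: "L ` S \<subseteq> S'"
    using T(2) by blast
  have spanL: "L ` span S \<subseteq> span S'"
    using span_mono[OF LS] linL by (simp add: linear_span_image)
  \<comment> \<open>The span of \<open>S'\<close> is inserted because the lattice condition on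
    \<open>M\<close> speaks only of lattice points inside it.\<close>
  have "(M \<circ> L) ` (N \<inter> span S) = M ` ((N' \<inter> span S') \<inter> L ` span S)"
    using latL spanL unfolding image_comp[symmetric] by (simp add: Int_absorb1 Int_assoc)
  also have "\<dots> = M ` (N' \<inter> span S') \<inter> M ` (L ` span S)"
    using spanL by (intro inj_on_image_Int[OF inj_span]) auto
  also have "\<dots> = N'' \<inter> M ` (L ` span S)"
    using spanL unfolding latM by blast
  finally have lat: "(M \<circ> L) ` (N \<inter> span S) = N'' \<inter> (M \<circ> L) ` span S"
    unfolding image_comp[symmetric] .
  have "inj_on (M \<circ> L) S"
    using injL inj_on_subset[OF inj LS] by (rule comp_inj_on)
  moreover have "(M \<circ> L) ` V \<subseteq> V''"
    using L M by (auto simp: lattice_preserving_iso_def lattice_preserving_inclusion_def)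
  ultimately show ?thesis
    using face lat linear_compose[OF linL lin] by (simp add: lattice_preserving_inclusion_def)
qed

lemma lattice_preserving_inclusion_id:
  assumes "convex S"
  shows "lattice_preserving_inclusion V N S V N S id"
proof -
  have "closure S face_of closure S" "S = S \<inter> closure S"
    using assms closure_subset[of S] by (auto intro: face_of_refl)
  then have "ideal_face S S"
    unfolding ideal_face_def by blast
  then show ?thesis
    by (simp add: lattice_preserving_inclusion_def linear_id)
qed

section \<open>Quotient maps and coproducts of cones\<close>

text \<open>Each quotient map factors through the other, and the two factors are mutually
  inverse.\<close>

lemma homeomorphic_space_quotient_maps:
  assumes f: "quotient_map X Y f" and g: "quotient_map X Z g"
    and eq: "\<And>x y. x \<in> topspace X \<Longrightarrow> y \<in> topspace X \<Longrightarrow> f x = f y \<longleftrightarrow> g x = g y"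
  shows "Y homeomorphic_space Z"
proof -
  obtain u where u: "continuous_map Y Z u" "\<And>x. x \<in> topspace X \<Longrightarrow> u (f x) = g x"
    by (rule quotient_map_lift_exists[OF f quotient_imp_continuous_map[OF g]]) (use eq in blast)+
  obtain v where v: "continuous_map Z Y v" "\<And>x. x \<in> topspace X \<Longrightarrow> v (g x) = f x"
    by (rule quotient_map_lift_exists[OF g quotient_imp_continuous_map[OF f]]) (use eq in blast)+
  have "topspace Y = f ` topspace X" "topspace Z = g ` topspace X"
    using f g by (simp_all add: quotient_map_def)
  then have "homeomorphic_maps Y Z u v"
    using u v by (simp add: homeomorphic_maps_def)
  then show ?thesis
    by (auto simp: homeomorphic_space_def)
qed

lemma topspace_cone_coproduct [simp]: "topspace (cone_coproduct F J) = (SIGMA i:J. fcone F i)"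
  by (auto simp: cone_coproduct_def)

lemma continuous_map_cone_coproduct:
  assumes "\<And>i. i \<in> I \<Longrightarrow> s i \<in> J" "\<And>i. i \<in> I \<Longrightarrow> continuous_on (fcone F i) (f i)"
    "\<And>i x. i \<in> I \<Longrightarrow> x \<in> fcone F i \<Longrightarrow> f i x \<in> fcone F (s i)"
  shows "continuous_map (cone_coproduct F I) (cone_coproduct F J) (\<lambda>p. (s (fst p), f (fst p) (snd p)))"
  unfolding continuous_map_def
proof (intro conjI allI impI)
  show "(\<lambda>p. (s (fst p), f (fst p) (snd p))) \<in>
      topspace (cone_coproduct F I) \<rightarrow> topspace (cone_coproduct F J)"
    using assms by auto
next
  fix U assume U: "openin (cone_coproduct F J) U"
  have "openin (top_of_set (fcone F i)) {x \<in> fcone F i. (s i, f i x) \<in> U}" if i: "i \<in> I" for i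
  proof -
    have "continuous_map (top_of_set (fcone F i)) (top_of_set (fcone F (s i))) (f i)"
      using assms i by auto
    moreover have "openin (top_of_set (fcone F (s i))) {y. (s i, y) \<in> U}"
      using U assms(1)[OF i] by (auto simp: cone_coproduct_def openin_sum_topology)
    ultimately have "openin (top_of_set (fcone F i))
        {x \<in> topspace (top_of_set (fcone F i)). f i x \<in> {y. (s i, y) \<in> U}}"
      by (rule openin_continuous_map_preimage)
    then show ?thesis
      by simp
  qed
  then show "openin (cone_coproduct F I)
      {p \<in> topspace (cone_coproduct F I). (s (fst p), f (fst p) (snd p)) \<in> U}"
    by (auto simp: cone_coproduct_def openin_sum_topology)
qed

text \<open>Induction along a chain of generators. The membership \<open>f p \<in> A\<close> serves
  the empty chain, as \<open>E\<close> is reflexive only on \<open>A\<close>.\<close>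

lemma equivclp_equiv:
  assumes E: "equiv A E" and step: "\<And>p q. r p q \<Longrightarrow> (f p, f q) \<in> E"
    and pq: "equivclp r p q" and p: "f p \<in> A"
  shows "(f p, f q) \<in> E"
  using pq
proof (induction rule: equivclp_induct)
  case base
  show ?case
    using E p by (auto simp: equiv_def refl_on_def)
next
  case (step y z)
  have "(f y, f z) \<in> E"
    using step.hyps(2) assms(2) E by (auto simp: equiv_def intro: symD)
  then show ?case
    using step.IH E by (auto simp: equiv_def intro: transD)
qed

section \<open>Equivariance and the comparison map\<close>

locale admissible_fan_action =
  fixes F :: "('i, 'v::real_inner) fan_data"
    and G :: "('g, 'b) monoid_scheme" (structure)
    and act :: "('i \<times> 'v) set \<Rightarrow> 'g \<Rightarrow> ('i \<times> 'v) set"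
    and mv :: "'i \<Rightarrow> 'g \<Rightarrow> 'i"
    and M :: "'g \<Rightarrow> 'i \<Rightarrow> 'v \<Rightarrow> 'v"
    and J :: "'i set"
  assumes fan: "ideal_stacky_fan F"
    and group: "group G"
    and admissible: "admissible_action F G act mv M"
    and representatives: "orbit_representatives F G mv J"
begin

interpretation group G by (rule group)

lemma topspace_fan_space: "topspace (fan_space F) = (SIGMA i:findex F. fcone F i) // fan_equiv F"
  by (simp add: fan_space_def)

lemma fan_point_in [intro]:
  "i \<in> findex F \<Longrightarrow> x \<in> fcone F i \<Longrightarrow> fan_point F i x \<in> topspace (fan_space F)"
  unfolding topspace_fan_space fan_point_def by (rule quotientI) simp

lemma act_in: "p \<in> topspace (fan_space F) \<Longrightarrow> g \<in> carrier G \<Longrightarrow> act p g \<in> topspace (fan_space F)"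
  and act_one: "p \<in> topspace (fan_space F) \<Longrightarrow> act p \<one> = p"
  and act_mult: "p \<in> topspace (fan_space F) \<Longrightarrow> g \<in> carrier G \<Longrightarrow> h \<in> carrier G \<Longrightarrow>
    act p (g \<otimes> h) = act (act p g) h"
  using admissible by (auto simp: admissible_action_def right_action_def)

lemma cone: "i \<in> findex F \<Longrightarrow> lattice_in (fspace F i) (flattice F i)"
    "i \<in> findex F \<Longrightarrow> ideal_cone (flattice F i) (fcone F i)"
  using fan by (auto simp: ideal_stacky_fan_def)

section \<open>Lifts of the action to single cones\<close>

text \<open>One notion for both ingredients of the stratified quotient: inclusions of faces are the
  lifts of the unit, the maps \<open>M g i\<close> are surjective lifts of \<open>g\<close>, and
  composing lifts multiplies group elements.\<close>

definition equivariant :: "'g \<Rightarrow> 'i \<Rightarrow> 'i \<Rightarrow> ('v \<Rightarrow> 'v) \<Rightarrow> bool" where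
  "equivariant g i j L \<longleftrightarrow> g \<in> carrier G \<and> i \<in> findex F \<and> j \<in> findex F \<and> incl_between F i j L \<and>
    (\<forall>x\<in>fcone F i. act (fan_point F i x) g = fan_point F j (L x))"

lemma equivariantD:
  assumes "equivariant g i j L"
  shows "g \<in> carrier G" "i \<in> findex F" "j \<in> findex F" "incl_between F i j L" "linear L"
    "inj_on L (fcone F i)"
    "x \<in> fcone F i \<Longrightarrow> L x \<in> fcone F j"
    "x \<in> fcone F i \<Longrightarrow> act (fan_point F i x) g = fan_point F j (L x)"
  using assms
  by (auto simp: equivariant_def lattice_preserving_inclusion_def ideal_face_def)

lemma equivariant_one_iff: "equivariant \<one> i j L \<longleftrightarrow> (i, j, L) \<in> face_inclusions F"
  by (simp add: equivariant_def face_inclusions_def act_one fan_point_in cong: conj_cong)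

lemma equivariant_id: "i \<in> findex F \<Longrightarrow> equivariant \<one> i i id"
  using cone(2) unfolding equivariant_one_iff face_inclusions_def
  by (auto simp: ideal_cone_def intro!: lattice_preserving_inclusion_id)

text \<open>Asking one factor to be onto avoids transitivity of the face relation. It suffices
  because the composites formed below contain at most one factor that is not onto.\<close>

lemma equivariant_comp:
  assumes L: "equivariant g i j L" and N: "equivariant h j k N"
    and img: "L ` fcone F i = fcone F j \<or> N ` fcone F j = fcone F k"
  shows "equivariant (g \<otimes> h) i k (N \<circ> L)"
proof -
  have "incl_between F i k (N \<circ> L)"
    using img
  proof
    assume "L ` fcone F i = fcone F j"
    then show ?thesis
      using equivariantD(4)[OF L] equivariantD(4)[OF N]
      by (intro lattice_preserving_inclusion_iso_comp) (auto simp: lattice_preserving_iso_def)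
  next
    assume "N ` fcone F j = fcone F k"
    then show ?thesis
      using equivariantD(4)[OF L] equivariantD(4)[OF N] cone equivariantD(3)[OF L]
      by (intro lattice_preserving_iso_inclusion_comp[of "fspace F j" "flattice F j" "fcone F j"])
         (auto simp: lattice_preserving_iso_def)
  qed
  moreover have "act (fan_point F i x) (g \<otimes> h) = fan_point F k ((N \<circ> L) x)" if "x \<in> fcone F i" for x
    using equivariantD[OF L] equivariantD[OF N] that by (auto simp: act_mult fan_point_in)
  ultimately show ?thesis
    using equivariantD[OF L] equivariantD[OF N] by (auto simp: equivariant_def)
qed

section \<open>The action on indices of cones\<close>

lemma mv_in: "i \<in> findex F \<Longrightarrow> g \<in> carrier G \<Longrightarrow> mv i g \<in> findex F"
  and equivariant_M: "i \<in> findex F \<Longrightarrow> g \<in> carrier G \<Longrightarrow> equivariant g i (mv i g) (M g i)"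
  and image_M: "i \<in> findex F \<Longrightarrow> g \<in> carrier G \<Longrightarrow> M g i ` fcone F i = fcone F (mv i g)"
  using admissible by (auto simp: admissible_action_def equivariant_def lattice_preserving_iso_def)

text \<open>
  A translated cone is determined by the group element, because the image of an interior point of
  the original cone lies in exactly one cell.
\<close>

lemma equivariant_iso_unique:
  assumes L: "equivariant g i j L" "L ` fcone F i = fcone F j"
    and N: "equivariant g i k N" "N ` fcone F i = fcone F k"
  shows "j = k"
proof -
  have i: "i \<in> findex F"
    using L(1) by (rule equivariantD)
  obtain D where D: "finite D" "D \<subseteq> fcone F i" "independent D" "span D = span (fcone F i)"
    using finite_basis_subset_lattice_in[OF cone(1)[OF i] ideal_cone_subset[OF cone[OF i]]] by metis
  \<comment> \<open>\<open>P\<close> sends \<open>D\<close> to a basis of the span of the target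
    cone, so \<open>P (\<Sum>D)\<close> is again the sum of a basis taken from the cone.\<close>
  have relint: "P (\<Sum>D) \<in> rel_interior (fcone F l)"
    if P: "equivariant g i l P" "P ` fcone F i = fcone F l" for l P
  proof -
    have inj: "inj_on P (span D)"
      using inj_on_span_ideal_cone[OF cone(2)[OF i]] equivariantD[OF P(1)] D(4) by simp
    have lin: "linear P"
      using P(1) by (rule equivariantD)
    have "\<Sum>(P ` D) \<in> rel_interior (fcone F l)"
    proof (rule sum_basis_in_rel_interior[OF cone(2)])
      show "l \<in> findex F"
        using P(1) by (rule equivariantD)
      show "span (P ` D) = span (fcone F l)"
        using lin D(4) P(2) by (metis linear_span_image)
      show "independent (P ` D)"
        using linear_independent_injective_image[OF lin D(3) inj] .
    qed (use D P in auto)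
    also have "\<Sum>(P ` D) = P (\<Sum>D)"
      using lin inj_on_subset[OF inj span_superset] by (simp add: sum.reindex linear_sum)
    finally show ?thesis .
  qed
  have "\<Sum>D \<in> fcone F i"
    using sum_basis_in_rel_interior[OF cone(2)[OF i] D] rel_interior_subset by blast
  then have eq: "fan_point F j (L (\<Sum>D)) = fan_point F k (N (\<Sum>D))"
    and "fan_point F j (L (\<Sum>D)) \<in> topspace (fan_space F)"
    using equivariantD[OF L(1)] equivariantD[OF N(1)] by (force, blast)
  then have "\<exists>!l. l \<in> findex F \<and>
      (\<exists>x\<in>rel_interior (fcone F l). fan_point F j (L (\<Sum>D)) = fan_point F l x)"
    using fan by (auto simp: ideal_stacky_fan_def)
  then show ?thesis
    using relint[OF L] relint[OF N] eq equivariantD(3)[OF L(1)] equivariantD(3)[OF N(1)] by blast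
qed

lemma mv_one: "i \<in> findex F \<Longrightarrow> mv i \<one> = i"
  using equivariant_iso_unique[OF equivariant_M image_M equivariant_id] by simp

text \<open>Both sides are targets of surjective lifts of \<open>g \<otimes> h\<close> from the same
  cone. The lifts may differ; only their targets are forced to agree.\<close>

lemma mv_mult:
  assumes "i \<in> findex F" "g \<in> carrier G" "h \<in> carrier G"
  shows "mv i (g \<otimes> h) = mv (mv i g) h"
proof (rule equivariant_iso_unique)
  show "equivariant (g \<otimes> h) i (mv (mv i g) h) (M h (mv i g) \<circ> M g i)"
    using equivariant_comp[OF equivariant_M equivariant_M] assms by (simp add: mv_in image_M)
  show "(M h (mv i g) \<circ> M g i) ` fcone F i = fcone F (mv (mv i g) h)"
    unfolding image_comp[symmetric] using assms by (simp add: mv_in image_M)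
  show "equivariant (g \<otimes> h) i (mv i (g \<otimes> h)) (M (g \<otimes> h) i)"
    "M (g \<otimes> h) i ` fcone F i = fcone F (mv i (g \<otimes> h))"
    using assms by (simp_all add: equivariant_M image_M)
qed

section \<open>The relation of the stratified quotient\<close>

definition strat_step :: "'i \<times> 'v \<Rightarrow> 'i \<times> 'v \<Rightarrow> bool" where
  "strat_step p q \<longleftrightarrow> (\<exists>i\<in>J. \<exists>j\<in>J. \<exists>g\<in>carrier G. \<exists>L. \<exists>x\<in>fcone F i.
    (mv i g, j, L) \<in> face_inclusions F \<and> p = (i, x) \<and> q = (j, L (M g i x)))"

definition strat :: "(('i \<times> 'v) \<times> ('i \<times> 'v)) set" where
  "strat = equiv_generated (SIGMA j:J. fcone F j) strat_step"

lemma stratified_quotient_eq: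
  "stratified_quotient F G mv M J = quotient_topology (cone_coproduct F J) strat"
  by (simp add: stratified_quotient_def strat_def strat_step_def[abs_def])

lemma equiv_strat: "equiv (SIGMA j:J. fcone F j) strat"
  unfolding strat_def by (rule equiv_equiv_generated)

lemma J_subset: "J \<subseteq> findex F"
  using representatives by (simp add: orbit_representatives_def)

lemma strat_generator:
  assumes "i \<in> J" "j \<in> J" "g \<in> carrier G" "equivariant \<one> (mv i g) j L" "x \<in> fcone F i"
  shows "((i, x), (j, L (M g i x))) \<in> strat"
proof -
  have "M g i x \<in> fcone F (mv i g)"
    using assms J_subset by (auto intro: equivariantD equivariant_M)
  then have "L (M g i x) \<in> fcone F j"
    using assms(4) by (auto intro: equivariantD)
  then show ?thesis
    using assms unfolding strat_def equiv_generated_def equivariant_one_iff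
    by (simp, intro r_into_equivclp) (auto simp: strat_step_def)
qed

text \<open>
  The map \<open>M \<one> i\<close> need not be the identity; its surjectivity replaces its inverse here and in
  the next lemma.
\<close>

lemma strat_equivariant_one:
  assumes "i \<in> J" "j \<in> J" "equivariant \<one> i j L" "z \<in> fcone F i"
  shows "((i, z), (j, L z)) \<in> strat"
proof -
  have i: "i \<in> findex F"
    using assms J_subset by blast
  then obtain w where w: "w \<in> fcone F i" "M \<one> i w = z"
    using image_M[of i \<one>] assms(4) mv_one[of i] by (metis imageE one_closed)
  have "((i, w), (i, z)) \<in> strat"
    using strat_generator[of i i \<one> id w] assms(1) i w equivariant_id by (simp add: mv_one)
  moreover have "((i, w), (j, L z)) \<in> strat"
    using strat_generator[of i j \<one> L w] assms i w by (simp add: mv_one)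
  ultimately show ?thesis
    using equiv_strat by (meson equiv_def symD transD)
qed

lemma strat_equivariant:
  assumes L: "equivariant g i i' L" and h: "h \<in> carrier G" "mv i h \<in> J"
    and h': "h' \<in> carrier G" "mv i' h' \<in> J" and x: "x \<in> fcone F i"
  shows "((mv i h, M h i x), (mv i' h', M h' i' (L x))) \<in> strat"
proof -
  \<comment> \<open>Since \<open>h \<otimes> k = g \<otimes> h'\<close>, the index \<open>l\<close>
    is the translate of \<open>i\<close> by \<open>g \<otimes> h'\<close>, the cone on which the
    conjugate of \<open>L\<close> starts. The map \<open>P\<close> leads from \<open>l\<close> back
    to \<open>i\<close>.\<close>
  define j j' k where "j = mv i h" and "j' = mv i' h'" and "k = inv h \<otimes> (g \<otimes> h')"
  define l where "l = mv j k"
  define P where "P = M (inv h) j \<circ> M (inv k) l"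
  have g: "g \<in> carrier G" and i: "i \<in> findex F" and i': "i' \<in> findex F"
    using L by (auto intro: equivariantD)
  have k: "k \<in> carrier G" and j: "j \<in> findex F" and l: "l \<in> findex F"
    using g h h' i by (auto simp: k_def j_def l_def mv_in)
  have mv_k: "mv l (inv k) = j"
    using k j by (simp add: l_def mv_mult[symmetric] mv_one)
  have mv_h: "mv j (inv h) = i"
    using h i by (simp add: j_def mv_mult[symmetric] mv_one)
  have P: "equivariant (inv k \<otimes> inv h) l i P"
    unfolding P_def using equivariant_M[OF l, of "inv k"] equivariant_M[OF j, of "inv h"]
      image_M[OF l, of "inv k"] k h mv_k mv_h
    by (intro equivariant_comp) auto
  have img_P: "P ` fcone F l = fcone F i"
    using image_M[OF l, of "inv k"] image_M[OF j, of "inv h"] k h mv_k mv_h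
    unfolding P_def image_comp[symmetric] by simp
  \<comment> \<open>\<open>w\<close> replaces \<open>M h i x\<close>. Both lie over the same point
    of the fan but may differ, because \<open>P \<circ> M k j\<close> need not invert
    \<open>M h i\<close>.\<close>
  obtain w where w: "w \<in> fcone F j" "P (M k j w) = x"
    using img_P image_M[OF j k] x unfolding l_def[symmetric] by (metis imageE)
  have "equivariant ((inv k \<otimes> inv h) \<otimes> g \<otimes> h') l j' (M h' i' \<circ> (L \<circ> P))"
    unfolding j'_def using P L equivariant_M[OF i' h'(1)] image_M[OF i' h'(1)] img_P
    by (intro equivariant_comp) auto
  moreover have "(inv k \<otimes> inv h) \<otimes> g \<otimes> h' = \<one>"
    using g h h' by (simp add: k_def m_assoc inv_mult_group)
  ultimately have "((j, w), (j', (M h' i' \<circ> (L \<circ> P)) (M k j w))) \<in> strat"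
    using h h' k w by (intro strat_generator) (simp_all add: j_def j'_def l_def del: comp_apply)
  then have 1: "((j, w), (j', M h' i' (L x))) \<in> strat"
    using w by simp
  \<comment> \<open>This loop at \<open>j\<close> covers the unit and takes \<open>w\<close> to
    \<open>M h i x\<close>, which corrects the replacement.\<close>
  have "equivariant (k \<otimes> (inv k \<otimes> inv h) \<otimes> h) j j (M h i \<circ> (P \<circ> M k j))"
    using P equivariant_M[OF i h(1)] image_M[OF i h(1)] equivariant_M[OF j k] image_M[OF j k]
    by (intro equivariant_comp) (auto simp: j_def[symmetric] l_def[symmetric])
  moreover have "k \<otimes> (inv k \<otimes> inv h) \<otimes> h = \<one>"
    using k h by (simp add: m_assoc[symmetric])
  ultimately have "((j, w), (j, (M h i \<circ> (P \<circ> M k j)) w)) \<in> strat"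
    using h w by (intro strat_equivariant_one) (simp_all add: j_def del: comp_apply)
  then have 2: "((j, w), (j, M h i x)) \<in> strat"
    using w by simp
  show ?thesis
    using 1 2 equiv_strat unfolding j_def j'_def by (meson equiv_def symD transD)
qed

section \<open>Moving points onto representative cones\<close>

definition to_rep :: "'i \<Rightarrow> 'g" where
  "to_rep i = (SOME g. g \<in> carrier G \<and> mv i g \<in> J)"

lemma to_rep: "to_rep i \<in> carrier G" "mv i (to_rep i) \<in> J" if "i \<in> findex F"
proof -
  have "\<exists>g. g \<in> carrier G \<and> mv i g \<in> J"
    using representatives that by (auto simp: orbit_representatives_def)
  then show "to_rep i \<in> carrier G" "mv i (to_rep i) \<in> J"
    unfolding to_rep_def by (metis (mono_tags, lifting) someI_ex)+
qed

text \<open>Even over \<open>J\<close> this need not be the identity: \<open>to_rep j\<close> may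
  fix the index \<open>j\<close> and still move points of its cone.\<close>

definition rep :: "'i \<times> 'v \<Rightarrow> 'i \<times> 'v" where
  "rep p = (mv (fst p) (to_rep (fst p)), M (to_rep (fst p)) (fst p) (snd p))"

lemma rep_in:
  assumes "p \<in> (SIGMA i:findex F. fcone F i)"
  shows "rep p \<in> (SIGMA j:J. fcone F j)"
proof -
  have "M (to_rep (fst p)) (fst p) (snd p) \<in> fcone F (mv (fst p) (to_rep (fst p)))"
    using assms by (intro equivariantD(7)[OF equivariant_M] to_rep) auto
  then show ?thesis
    using assms to_rep by (auto simp: rep_def)
qed

section \<open>The orbit relation on the fan\<close>

definition orbit_rel :: "(('i \<times> 'v) set \<times> ('i \<times> 'v) set) set" where
  "orbit_rel = {(p, q). p \<in> topspace (fan_space F) \<and> (\<exists>g\<in>carrier G. q = act p g)}"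

lemma equiv_orbit_rel: "equiv (topspace (fan_space F)) orbit_rel"
proof (rule equivI)
  show "orbit_rel \<subseteq> topspace (fan_space F) \<times> topspace (fan_space F)"
    by (auto simp: orbit_rel_def act_in)
  show "refl_on (topspace (fan_space F)) orbit_rel"
    by (auto simp: refl_on_def orbit_rel_def act_in intro!: bexI[of _ \<one>] simp: act_one)
  show "sym orbit_rel"
  proof (rule symI)
    fix p q assume "(p, q) \<in> orbit_rel"
    then obtain g where g: "p \<in> topspace (fan_space F)" "g \<in> carrier G" "q = act p g"
      by (auto simp: orbit_rel_def)
    then have "act q (inv g) = p"
      by (simp add: act_mult[symmetric] act_one)
    then show "(q, p) \<in> orbit_rel"
      using g by (auto simp: orbit_rel_def act_in intro!: bexI[of _ "inv g"])
  qed
  show "trans orbit_rel"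
  proof (rule transI)
    fix p q r assume "(p, q) \<in> orbit_rel" "(q, r) \<in> orbit_rel"
    then obtain g h where "p \<in> topspace (fan_space F)" "g \<in> carrier G" "q = act p g"
        "h \<in> carrier G" "r = act q h"
      by (auto simp: orbit_rel_def)
    then show "(p, r) \<in> orbit_rel"
      by (auto simp: orbit_rel_def act_mult[symmetric])
  qed
qed

lemma orbit_rel_equivariant:
  assumes "equivariant g i j L" "x \<in> fcone F i"
  shows "(fan_point F i x, fan_point F j (L x)) \<in> orbit_rel"
  using equivariantD[OF assms(1)] assms(2) by (force simp: orbit_rel_def)

section \<open>Comparison of the two relations\<close>

lemma strat_rep_equivariant:
  assumes "equivariant g i j L" "x \<in> fcone F i"
  shows "(rep (i, x), rep (j, L x)) \<in> strat"
  using strat_equivariant[OF assms(1) to_rep to_rep assms(2)] equivariantD[OF assms(1)]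
  by (simp add: rep_def)

text \<open>The generators of the fan relation are lifts of the unit, and \<open>rep\<close> turns
  the two ends of any lift into equivalent points.\<close>

lemma strat_rep_fan_equiv:
  assumes "(p, q) \<in> fan_equiv F"
  shows "(rep p, rep q) \<in> strat"
proof -
  let ?r = "\<lambda>p q. \<exists>i j L x. (i, j, L) \<in> fincl F \<and> x \<in> fcone F i \<and> p = (i, x) \<and> q = (j, L x)"
  have gen: "(rep p, rep q) \<in> strat" if "?r p q" for p q
    using that fincl_subset_face_inclusions[OF fan] strat_rep_equivariant[of \<one>]
    by (fastforce simp: equivariant_one_iff)
  have p: "p \<in> (SIGMA i:findex F. fcone F i)" and "equivclp ?r p q"
    using assms by (auto simp: fan_equiv_def equiv_generated_def)
  then show ?thesis
    using equivclp_equiv[OF equiv_strat, of ?r rep p q] gen rep_in[OF p] by blast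
qed

text \<open>A generator is a lift of some \<open>g\<close> followed by a lift of the unit, so it
  stays within one orbit.\<close>

lemma orbit_rel_strat:
  assumes "(p, q) \<in> strat"
  shows "(fan_point F (fst p) (snd p), fan_point F (fst q) (snd q)) \<in> orbit_rel"
proof -
  have gen: "(fan_point F (fst p) (snd p), fan_point F (fst q) (snd q)) \<in> orbit_rel"
    if pq: "strat_step p q" for p q
  proof -
    obtain i j g L x where *: "i \<in> J" "g \<in> carrier G" "x \<in> fcone F i"
      "equivariant \<one> (mv i g) j L" "p = (i, x)" "q = (j, L (M g i x))"
      using pq by (auto simp: equivariant_one_iff strat_step_def)
    have M: "equivariant g i (mv i g) (M g i)"
      using * J_subset by (intro equivariant_M) auto
    then show ?thesis
      using orbit_rel_equivariant[OF M *(3)] orbit_rel_equivariant[OF *(4) equivariantD(7)[OF M *(3)]]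
        equiv_orbit_rel * by (simp add: equiv_def) (meson transD)
  qed
  have p: "p \<in> (SIGMA i:J. fcone F i)" and "equivclp strat_step p q"
    using assms by (auto simp: strat_def equiv_generated_def)
  moreover have "fan_point F (fst p) (snd p) \<in> topspace (fan_space F)"
    using p J_subset by (auto intro!: fan_point_in)
  ultimately show ?thesis
    using equivclp_equiv[OF equiv_orbit_rel, of strat_step "\<lambda>p. fan_point F (fst p) (snd p)" p q] gen
    by blast
qed

lemma orbit_rel_rep:
  assumes "p \<in> (SIGMA i:findex F. fcone F i)"
  shows "(fan_point F (fst p) (snd p), fan_point F (fst (rep p)) (snd (rep p))) \<in> orbit_rel"
  using assms orbit_rel_equivariant[OF equivariant_M] to_rep by (auto simp: rep_def)

lemma same_fibres:
  assumes p: "p \<in> (SIGMA i:findex F. fcone F i)" and q: "q \<in> (SIGMA i:findex F. fcone F i)"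
  shows "(fan_equiv F `` {p}, fan_equiv F `` {q}) \<in> orbit_rel \<longleftrightarrow> (rep p, rep q) \<in> strat"
proof
  assume "(fan_equiv F `` {p}, fan_equiv F `` {q}) \<in> orbit_rel"
  then obtain g where g: "g \<in> carrier G" "fan_equiv F `` {q} = act (fan_equiv F `` {p}) g"
    by (auto simp: orbit_rel_def)
  obtain i x where ix: "p = (i, x)" "i \<in> findex F" "x \<in> fcone F i"
    using p by auto
  have M: "equivariant g i (mv i g) (M g i)"
    using ix g by (intro equivariant_M)
  \<comment> \<open>The group acts only on classes; \<open>M g i\<close> supplies a point of the
    coproduct representing the translated class, which can then be compared with \<open>q\<close> by
    \<open>fan_equiv F\<close>.\<close>
  have "fan_equiv F `` {q} = fan_equiv F `` {(mv i g, M g i x)}"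
    using g(2) equivariantD(8)[OF M ix(3)] ix(1) by (simp add: fan_point_def)
  then have "((mv i g, M g i x), q) \<in> fan_equiv F"
    using eq_equiv_class[OF _ equiv_fan_equiv q] by metis
  then show "(rep p, rep q) \<in> strat"
    using strat_rep_equivariant[OF M ix(3)] strat_rep_fan_equiv ix(1) equiv_strat
    by (meson equiv_def transD)
next
  assume "(rep p, rep q) \<in> strat"
  \<comment> \<open>Applying \<open>rep\<close> stays within the orbit, so the conclusion passes
    from \<open>rep p\<close> and \<open>rep q\<close> back to \<open>p\<close> and
    \<open>q\<close>.\<close>
  from orbit_rel_strat[OF this] show "(fan_equiv F `` {p}, fan_equiv F `` {q}) \<in> orbit_rel"
    using orbit_rel_rep[OF p] orbit_rel_rep[OF q] equiv_orbit_rel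
    by (simp add: fan_point_def) (meson equiv_def symD transD)
qed

text \<open>A continuous map is a quotient map once its composite with some continuous map into its
  domain is one. Here that map is the inclusion of the coproduct over \<open>J\<close>: the
  composite equals the defining projection, since \<open>rep\<close> moves points over
  \<open>J\<close> only within their classes.\<close>

lemma quotient_map_rep:
  "quotient_map (cone_coproduct F (findex F)) (stratified_quotient F G mv M J) (\<lambda>p. strat `` {rep p})"
proof (rule quotient_map_from_composition)
  have r: "quotient_map (cone_coproduct F J) (stratified_quotient F G mv M J) (\<lambda>p. strat `` {p})"
    unfolding stratified_quotient_eq by (rule quotient_map_quotient_topology)
  have "continuous_map (cone_coproduct F J) (cone_coproduct F (findex F)) (\<lambda>p. (fst p, snd p))"
    using J_subset by (intro continuous_map_cone_coproduct) auto
  then show "continuous_map (cone_coproduct F J) (cone_coproduct F (findex F)) (\<lambda>p. p)"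
    by simp
  have "continuous_map (cone_coproduct F (findex F)) (cone_coproduct F J) rep"
    unfolding rep_def
  proof (rule continuous_map_cone_coproduct)
    fix i assume i: "i \<in> findex F"
    show "continuous_on (fcone F i) (M (to_rep i) i)"
      using equivariantD(5)[OF equivariant_M[OF i]] to_rep[OF i]
      by (intro linear_continuous_on_ideal_cone[OF cone[OF i]])
    show "M (to_rep i) i x \<in> fcone F (mv i (to_rep i))" if "x \<in> fcone F i" for x
      using image_M[OF i] to_rep[OF i] that by blast
  qed (rule to_rep)
  from continuous_map_compose[OF this quotient_imp_continuous_map[OF r]]
  show "continuous_map (cone_coproduct F (findex F)) (stratified_quotient F G mv M J)
      (\<lambda>p. strat `` {rep p})"
    by (simp add: o_def)
  have rep_J: "(p, rep p) \<in> strat" if p: "p \<in> (SIGMA j:J. fcone F j)" for p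
  proof -
    obtain j x where jx: "p = (j, x)" "j \<in> J" "x \<in> fcone F j"
      using p by auto
    then have j: "j \<in> findex F"
      using J_subset by blast
    \<comment> \<open>Both \<open>j\<close>, reached by the unit, and \<open>mv j (to_rep j)\<close>
      represent the orbit of \<open>j\<close>, and the representative is unique.\<close>
    have "mv j (to_rep j) = j"
      using representatives jx(2) to_rep[OF j] mv_one[OF j] j one_closed
      unfolding orbit_representatives_def by metis
    then show ?thesis
      using strat_generator[of j j "to_rep j" id x] jx to_rep[OF j] equivariant_id[OF j]
      by (simp add: rep_def)
  qed
  show "quotient_map (cone_coproduct F J) (stratified_quotient F G mv M J)
      ((\<lambda>p. strat `` {rep p}) \<circ> (\<lambda>p. p))"
  proof (rule quotient_map_eq[OF r])
    show "strat `` {p} = ((\<lambda>p. strat `` {rep p}) \<circ> (\<lambda>p. p)) p"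
      if "p \<in> topspace (cone_coproduct F J)" for p
      using equiv_class_eq[OF equiv_strat rep_J] that by simp
  qed
qed

lemma homeomorphic_quotients: "global_quotient F G act homeomorphic_space stratified_quotient F G mv M J"
proof (rule homeomorphic_space_quotient_maps[OF _ quotient_map_rep])
  have "quotient_map (fan_space F) (global_quotient F G act) (\<lambda>P. orbit_rel `` {P})"
    unfolding global_quotient_def orbit_rel_def by (rule quotient_map_quotient_topology)
  moreover have "quotient_map (cone_coproduct F (findex F)) (fan_space F) (\<lambda>p. fan_equiv F `` {p})"
    unfolding fan_space_def by (rule quotient_map_quotient_topology)
  ultimately show "quotient_map (cone_coproduct F (findex F)) (global_quotient F G act)
      ((\<lambda>P. orbit_rel `` {P}) \<circ> (\<lambda>p. fan_equiv F `` {p}))"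
    by (blast intro: quotient_map_compose)
next
  fix p q assume "p \<in> topspace (cone_coproduct F (findex F))" "q \<in> topspace (cone_coproduct F (findex F))"
  then have p: "p \<in> (SIGMA i:findex F. fcone F i)" and q: "q \<in> (SIGMA i:findex F. fcone F i)"
    by simp_all
  have "fan_equiv F `` {p} \<in> topspace (fan_space F)" "fan_equiv F `` {q} \<in> topspace (fan_space F)"
    using p q fan_point_in by (auto simp: fan_point_def)
  then have "orbit_rel `` {fan_equiv F `` {p}} = orbit_rel `` {fan_equiv F `` {q}} \<longleftrightarrow>
      (fan_equiv F `` {p}, fan_equiv F `` {q}) \<in> orbit_rel"
    by (rule eq_equiv_class_iff[OF equiv_orbit_rel])
  moreover have "rep p \<in> (SIGMA j:J. fcone F j)" "rep q \<in> (SIGMA j:J. fcone F j)"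
    by (rule rep_in[OF p], rule rep_in[OF q])
  then have "strat `` {rep p} = strat `` {rep q} \<longleftrightarrow> (rep p, rep q) \<in> strat"
    by (rule eq_equiv_class_iff[OF equiv_strat])
  ultimately show "((\<lambda>P. orbit_rel `` {P}) \<circ> (\<lambda>p. fan_equiv F `` {p})) p =
      ((\<lambda>P. orbit_rel `` {P}) \<circ> (\<lambda>p. fan_equiv F `` {p})) q \<longleftrightarrow> strat `` {rep p} = strat `` {rep q}"
    using same_fibres[OF p q] by simp
qed

end

theorem proposition2p2p9:
  fixes F :: "('i, 'v::real_inner) fan_data"
    and G :: "('g, 'b) monoid_scheme"
    and act :: "('i \<times> 'v) set \<Rightarrow> 'g \<Rightarrow> ('i \<times> 'v) set"
    and mv :: "'i \<Rightarrow> 'g \<Rightarrow> 'i"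
    and M :: "'g \<Rightarrow> 'i \<Rightarrow> 'v \<Rightarrow> 'v"
    and J :: "'i set"
  assumes "ideal_stacky_fan F"
    and "group G"
    and "admissible_action F G act mv M"
    and "orbit_representatives F G mv J"
  shows "global_quotient F G act homeomorphic_space stratified_quotient F G mv M J"
proof -
  interpret admissible_fan_action F G act mv M J
    using assms by (simp add: admissible_fan_action_def)
  show ?thesis
    by (rule homeomorphic_quotients)
qed

end
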